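(* Let $X$ be a centered Gaussian process. If $$\sup_{n\in \mathbb{N}}2^{n}\sum_{k = 1}^{2^n}\mathbb{E}\left[\left(X\Big(\frac{k}{2^n}\Big)-X\Big(\frac{k-1}{2^n}\Big)\right)^2\right] < \infty,$$ then the sum $$2^{n}\sum_{k = 1}^{2^n}\left(X\Big(\frac{k}{2^n}\Big)-X\Big(\frac{k-1}{2^n}\Big)\right)^2$$ converges to some non-constant random variable in $L^p$ as $n \to \infty$ for all $p \in (1,\infty)$.
   Context: The process $X = \{X(t), t\in[0,\infty)\}$ is real-valued; only its values at dyadic points of $[0,1]$ enter the statement.
   Formalization: The limit is claimed to be non-constant only when some dyadic increment of X on [0,1] is not almost surely zero; otherwise (for example X = 0) all the sums vanish and the limit is the constant 0. Convergence in L^p is shown for every X. *)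

theory Defs
  imports "HOL-Probability.Probability"
begin

text \<open>A Gaussian random variable may be degenerate, i.e. almost surely constant (variance 0).
  This case has no Lebesgue density and so needs a disjunct of its own.\<close>

definition gaussian_rv :: "'a measure \<Rightarrow> ('a \<Rightarrow> real) \<Rightarrow> bool" where
  "gaussian_rv M Y \<longleftrightarrow> Y \<in> borel_measurable M \<and>
     (\<exists>\<mu>. (AE \<omega> in M. Y \<omega> = \<mu>) \<or> (\<exists>\<sigma>>0. distributed M lborel Y (normal_density \<mu> \<sigma>)))"

text \<open>A process is Gaussian if its finite-dimensional distributions are multivariate normal,
  i.e. if every finite linear combination of its values is a Gaussian random variable.\<close>

definition gaussian_process ::
    "'a measure \<Rightarrow> real set \<Rightarrow> (real \<Rightarrow> 'a \<Rightarrow> real) \<Rightarrow> bool" where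
  "gaussian_process M T X \<longleftrightarrow>
     (\<forall>F c. finite F \<and> F \<subseteq> T \<longrightarrow> gaussian_rv M (\<lambda>\<omega>. \<Sum>t\<in>F. c t * X t \<omega>))"

definition centered_gaussian_process ::
    "'a measure \<Rightarrow> real set \<Rightarrow> (real \<Rightarrow> 'a \<Rightarrow> real) \<Rightarrow> bool" where
  "centered_gaussian_process M T X \<longleftrightarrow>
     gaussian_process M T X \<and> (\<forall>t\<in>T. (\<integral>\<omega>. X t \<omega> \<partial>M) = 0)"

definition in_Lp :: "'a measure \<Rightarrow> real \<Rightarrow> ('a \<Rightarrow> real) \<Rightarrow> bool" where
  "in_Lp M p f \<longleftrightarrow> f \<in> borel_measurable M \<and> integrable M (\<lambda>\<omega>. \<bar>f \<omega>\<bar> powr p)"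

definition Lp_norm :: "'a measure \<Rightarrow> real \<Rightarrow> ('a \<Rightarrow> real) \<Rightarrow> real" where
  "Lp_norm M p f = (\<integral>\<omega>. \<bar>f \<omega>\<bar> powr p \<partial>M) powr (1 / p)"

text \<open>Membership is required explicitly because the Bochner integral of a non-integrable
  function is 0, so that a vanishing \<open>Lp_norm\<close> alone would carry no information.\<close>

definition converges_in_Lp ::
    "'a measure \<Rightarrow> real \<Rightarrow> (nat \<Rightarrow> 'a \<Rightarrow> real) \<Rightarrow> ('a \<Rightarrow> real) \<Rightarrow> bool" where
  "converges_in_Lp M p S Y \<longleftrightarrow>
     (\<forall>n. in_Lp M p (S n)) \<and> in_Lp M p Y \<and>
     (\<lambda>n. Lp_norm M p (\<lambda>\<omega>. S n \<omega> - Y \<omega>)) \<longlonglongrightarrow> 0"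

text \<open>Constancy of a random variable is understood up to null sets.\<close>

definition nonconstant_rv :: "'a measure \<Rightarrow> ('a \<Rightarrow> real) \<Rightarrow> bool" where
  "nonconstant_rv M Y \<longleftrightarrow> Y \<in> borel_measurable M \<and> \<not> (\<exists>c. AE \<omega> in M. Y \<omega> = c)"

definition dyadic_increment :: "(real \<Rightarrow> 'a \<Rightarrow> real) \<Rightarrow> nat \<Rightarrow> nat \<Rightarrow> 'a \<Rightarrow> real" where
  "dyadic_increment X n k \<omega> = X (real k / 2 ^ n) \<omega> - X ((real k - 1) / 2 ^ n) \<omega>"

text \<open>The degenerate processes that do not move along the dyadic points of the unit interval
  (for instance the zero process). For these the limit of the scaled sums is the constant 0.\<close>

definition dyadically_constant :: "'a measure \<Rightarrow> (real \<Rightarrow> 'a \<Rightarrow> real) \<Rightarrow> bool" where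
  "dyadically_constant M X \<longleftrightarrow>
     (\<forall>n. \<forall>k\<in>{1..2 ^ n}. AE \<omega> in M. dyadic_increment X n k \<omega> = 0)"

end

theory Submission
  imports Defs
begin

text \<open>Let $S_n$ be the scaled dyadic sums. Since $(a + b)^2 \<le> 2 (a^2 + b^2)$, they increase
  pointwise. Gaussian moments and Jensen's inequality turn the bound on $E\,S_n$ into a bound on every
  moment of $S_n$, so the supremum $Y$ of the $S_n$ has finite moments and dominates them, which gives
  convergence in $L^p$. For an increment $U$ with $E\,U^2 > 0$, Isserlis' formula shows that
  $\mathrm{Cov}(S_n, U^2)$ is twice the deterministic dyadic sum of $t \mapsto E[X_t U]$. This is again
  increasing in $n$ and eventually positive, so $Y$ is correlated with $U^2$ and cannot be constant.\<close>

section \<open>Dyadic energy of a real function\<close>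

text \<open>This is the integral over \<open>[0,1]\<close> of the squared slope of the piecewise
  linear interpolation of \<open>f\<close> at level \<open>n\<close>. It is applied both to sample
  paths and to deterministic covariance functions.\<close>

definition dyadic_energy :: "(real \<Rightarrow> real) \<Rightarrow> nat \<Rightarrow> real" where
  "dyadic_energy f n = 2 ^ n * (\<Sum>k = 1..2 ^ n. (f (real k / 2 ^ n) - f ((real k - 1) / 2 ^ n))\<^sup>2)"

lemma dyadic_energy_nonneg: "0 \<le> dyadic_energy f n"
  by (simp add: dyadic_energy_def sum_nonneg)

lemma sum_pairs: "(\<Sum>k = 1..2 * m. g k) = (\<Sum>k = 1..m. g (2 * k - 1) + g (2 * k))"
  for g :: "nat \<Rightarrow> real"
  by (induction m) (simp_all add: algebra_simps)

text \<open>Each interval is split at its midpoint. The factor 2 lost in the square of a sum of two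
  increments is exactly the factor that the weight gains from \<open>2 ^ n\<close> to
  \<open>2 ^ Suc n\<close>.\<close>

lemma incseq_dyadic_energy: "incseq (dyadic_energy f)"
proof (rule incseq_SucI)
  fix n
  let ?m = "2 ^ n :: nat"
  let ?d = "\<lambda>k. (f (real k / 2 ^ Suc n) - f ((real k - 1) / 2 ^ Suc n))\<^sup>2"
  have "2 * (\<Sum>k = 1..2 ^ Suc n. ?d k) = (\<Sum>k = 1..?m. 2 * (?d (2 * k - 1) + ?d (2 * k)))"
    using sum_pairs[of ?d ?m] by (simp add: sum_distrib_left)
  moreover have "(\<Sum>k = 1..?m. (f (real k / 2 ^ n) - f ((real k - 1) / 2 ^ n))\<^sup>2) \<le> \<dots>"
  proof (rule sum_mono)
    fix k assume "k \<in> {1..?m}"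
    \<comment> \<open>\<open>k \<ge> 1\<close> keeps the subtraction on the naturals from
      truncating.\<close>
    then have "real (2 * k - 1) = 2 * real k - 1" by (simp add: of_nat_diff)
    moreover have "(2 * real k - 1 - 1) / 2 ^ Suc n = (real k - 1) / 2 ^ n"
      "real (2 * k) / 2 ^ Suc n = real k / 2 ^ n"
      by (simp_all add: field_simps)
    \<comment> \<open>The right side minus the left is the square of
      \<open>(a - b) - (b - c)\<close>.\<close>
    moreover have "(a - c)\<^sup>2 \<le> 2 * ((b - c)\<^sup>2 + (a - b)\<^sup>2)" for a b c :: real
      using zero_le_power2[of "a - b - (b - c)"] by (simp add: power2_eq_square algebra_simps)
    ultimately show "(f (real k / 2 ^ n) - f ((real k - 1) / 2 ^ n))\<^sup>2
        \<le> 2 * (?d (2 * k - 1) + ?d (2 * k))"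
      by simp
  qed
  ultimately have "2 ^ n * (\<Sum>k = 1..?m. (f (real k / 2 ^ n) - f ((real k - 1) / 2 ^ n))\<^sup>2)
      \<le> 2 ^ n * (2 * (\<Sum>k = 1..2 ^ Suc n. ?d k))"
    by (intro mult_left_mono) simp_all
  then show "dyadic_energy f n \<le> dyadic_energy f (Suc n)"
    by (simp add: dyadic_energy_def mult.assoc mult.left_commute)
qed

section \<open>Moments of sums of nonnegative variables\<close>

text \<open>Jensen's inequality for the \<open>m\<close>-th power on the half line: with
  \<open>V\<close> the total of the \<open>v i\<close>, the points \<open>x i / v i\<close> with
  weights \<open>v i / V\<close> average to \<open>(\<Sum>i\<in>A. x i) / V\<close>.\<close>

lemma sum_power_le_weighted:
  fixes x v :: "'i \<Rightarrow> real"
  assumes "finite A" "A \<noteq> {}" and x: "\<And>i. i \<in> A \<Longrightarrow> 0 \<le> x i" and v: "\<And>i. i \<in> A \<Longrightarrow> 0 < v i"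
  shows "(\<Sum>i\<in>A. x i) ^ m \<le> (\<Sum>i\<in>A. v i) ^ m * (\<Sum>i\<in>A. v i / (\<Sum>i\<in>A. v i) * (x i / v i) ^ m)"
proof -
  define V where "V = (\<Sum>i\<in>A. v i)"
  have V: "0 < V" unfolding V_def using assms by (intro sum_pos) auto
  have cvx: "convex_on {0::real..} (\<lambda>x. x ^ m)"
    by (cases "even m") (auto intro: convex_power_odd convex_on_subset[OF convex_power_even])
  have "(\<Sum>i\<in>A. (v i / V) *\<^sub>R (x i / v i)) ^ m \<le> (\<Sum>i\<in>A. v i / V * (x i / v i) ^ m)"
  proof (rule convex_on_sum[OF assms(1,2) cvx])
    show "(\<Sum>i\<in>A. v i / V) = 1"
      using V by (simp add: V_def flip: sum_divide_distrib)
  qed (use V x v in \<open>auto intro!: divide_nonneg_pos dest: less_imp_le\<close>)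
  moreover have "(\<Sum>i\<in>A. (v i / V) *\<^sub>R (x i / v i)) = (\<Sum>i\<in>A. x i) / V"
    unfolding sum_divide_distrib by (intro sum.cong refl) (use v in force)
  ultimately have "((\<Sum>i\<in>A. x i) / V) ^ m \<le> (\<Sum>i\<in>A. v i / V * (x i / v i) ^ m)"
    by simp
  then have "(\<Sum>i\<in>A. x i) ^ m / V ^ m \<le> (\<Sum>i\<in>A. v i / V * (x i / v i) ^ m)"
    by (simp only: power_divide)
  then show ?thesis
    using V by (simp only: pos_divide_le_eq zero_less_power mult.commute[of "V ^ m"] flip: V_def)
qed

context prob_space
begin

text \<open>In the weighted Jensen bound each ratio \<open>(x i / v i) ^ m\<close> has expectation
  at most \<open>c\<close>, and the weights sum to 1, so the number of summands does not enter the
  constant. Indices with \<open>v i = 0\<close> admit no ratio, but contribute nothing almost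
  surely; \<open>B\<close> drops them.\<close>

lemma expectation_sum_power_le:
  fixes x :: "'i \<Rightarrow> 'a \<Rightarrow> real"
  assumes "finite A" and [measurable]: "\<And>i. i \<in> A \<Longrightarrow> x i \<in> borel_measurable M"
    and x: "\<And>i \<omega>. i \<in> A \<Longrightarrow> 0 \<le> x i \<omega>"
    and int: "\<And>i. i \<in> A \<Longrightarrow> integrable M (\<lambda>\<omega>. x i \<omega> ^ m)"
    and le: "\<And>i. i \<in> A \<Longrightarrow> expectation (\<lambda>\<omega>. x i \<omega> ^ m) \<le> c * v i ^ m"
    and v: "\<And>i. i \<in> A \<Longrightarrow> 0 \<le> v i"
    and null: "\<And>i. i \<in> A \<Longrightarrow> v i = 0 \<Longrightarrow> AE \<omega> in M. x i \<omega> = 0"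
    and c: "1 \<le> c"
  shows "integrable M (\<lambda>\<omega>. (\<Sum>i\<in>A. x i \<omega>) ^ m)"
    and "expectation (\<lambda>\<omega>. (\<Sum>i\<in>A. x i \<omega>) ^ m) \<le> c * (\<Sum>i\<in>A. v i) ^ m"
proof -
  define B where "B = {i \<in> A. v i \<noteq> 0}"
  define V where "V = (\<Sum>i\<in>B. v i)"
  have B: "finite B" "B \<subseteq> A" "\<And>i. i \<in> B \<Longrightarrow> 0 < v i"
    using assms(1) v by (auto simp: B_def order.strict_iff_order)
  have V_eq: "(\<Sum>i\<in>A. v i) = V"
    unfolding V_def B_def using assms(1) by (intro sum.mono_neutral_right) auto
  have "AE \<omega> in M. \<forall>i\<in>A - B. x i \<omega> = 0"
    using assms(1) null by (intro AE_finite_allI) (auto simp: B_def)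
  then have sum_eq: "AE \<omega> in M. (\<Sum>i\<in>A. x i \<omega>) = (\<Sum>i\<in>B. x i \<omega>)"
    by eventually_elim (use assms(1) B in \<open>intro sum.mono_neutral_right, auto\<close>)
  have "integrable M (\<lambda>\<omega>. (\<Sum>i\<in>A. x i \<omega>) ^ m) \<and>
      expectation (\<lambda>\<omega>. (\<Sum>i\<in>A. x i \<omega>) ^ m) \<le> c * (\<Sum>i\<in>A. v i) ^ m" (is "?I \<and> ?E")
  proof (cases "B = {}")
    case True
    then have *: "AE \<omega> in M. (\<Sum>i\<in>A. x i \<omega>) ^ m = 0 ^ m"
      using sum_eq by auto
    have ?I by (rule integrable_cong_AE_imp[of _ "\<lambda>_. 0 ^ m"]) (use * in \<open>auto simp: eq_commute\<close>)
    moreover have "expectation (\<lambda>\<omega>. (\<Sum>i\<in>A. x i \<omega>) ^ m) = 0 ^ m"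
      using integral_cong_AE[OF _ _ *] by (simp add: prob_space)
    moreover have "V = 0" using True by (simp add: V_def)
    \<comment> \<open>Both sides are multiples of \<open>0 ^ m\<close>. For \<open>m = 0\<close>
      this is 1 and the claim becomes \<open>1 \<le> c\<close>.\<close>
    ultimately show ?thesis using c by (cases m) (simp_all add: V_eq)
  next
    case False
    have V: "0 < V" unfolding V_def using B False by (intro sum_pos) auto
    let ?R = "\<lambda>\<omega>. V ^ m * (\<Sum>i\<in>B. v i / V * (x i \<omega> / v i) ^ m)"
    have intR: "integrable M ?R"
      unfolding power_divide using int B(2)
      by (intro integrable_mult_right Bochner_Integration.integrable_sum integrable_divide) auto
    have bound: "AE \<omega> in M. (\<Sum>i\<in>A. x i \<omega>) ^ m \<le> ?R \<omega>"
      using sum_eq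
    proof eventually_elim
      case (elim \<omega>)
      then show ?case
        using sum_power_le_weighted[OF B(1) False, of "\<lambda>i. x i \<omega>" v m] B x by (auto simp: V_def)
    qed
    have nonneg: "0 \<le> (\<Sum>i\<in>A. x i \<omega>) ^ m" for \<omega>
      using x by (auto intro!: zero_le_power sum_nonneg)
    have I: ?I
    proof (rule Bochner_Integration.integrable_bound[OF intR])
      show "AE \<omega> in M. norm ((\<Sum>i\<in>A. x i \<omega>) ^ m) \<le> norm (?R \<omega>)"
        using bound
      proof eventually_elim
        case (elim \<omega>)
        then show ?case using nonneg[of \<omega>] by simp
      qed
    qed simp
    have "expectation (\<lambda>\<omega>. (\<Sum>i\<in>A. x i \<omega>) ^ m) \<le> expectation ?R"
      by (rule integral_mono_AE[OF I intR bound])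
    also have "\<dots> = V ^ m * (\<Sum>i\<in>B. v i / V * (expectation (\<lambda>\<omega>. x i \<omega> ^ m) / v i ^ m))"
      using B int by (simp add: power_divide subset_iff)
    also have "\<dots> \<le> V ^ m * (\<Sum>i\<in>B. v i / V * c)"
    proof (intro mult_left_mono sum_mono)
      fix i assume i: "i \<in> B"
      show "expectation (\<lambda>\<omega>. x i \<omega> ^ m) / v i ^ m \<le> c"
        using le[of i] B i by (auto simp: divide_le_eq)
    qed (use B V in \<open>auto intro: less_imp_le\<close>)
    also have "\<dots> = c * V ^ m"
      using V by (simp add: V_def flip: sum_distrib_right sum_divide_distrib)
    finally show ?thesis using I by (simp add: V_eq)
  qed
  then show "integrable M (\<lambda>\<omega>. (\<Sum>i\<in>A. x i \<omega>) ^ m)"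
    and "expectation (\<lambda>\<omega>. (\<Sum>i\<in>A. x i \<omega>) ^ m) \<le> c * (\<Sum>i\<in>A. v i) ^ m"
    by auto
qed

section \<open>Moments of Gaussian variables\<close>

text \<open>The factor is the double factorial \<open>(2 * m - 1)!!\<close>. Expressing the moment
  through the second moment rather than a density parameter lets one formula cover the degenerate
  case as well.\<close>

lemma gaussian_rv_even_moment:
  assumes "gaussian_rv M W" and mean: "expectation W = 0"
  shows "integrable M (\<lambda>\<omega>. W \<omega> ^ (2 * m))"
    and "expectation (\<lambda>\<omega>. W \<omega> ^ (2 * m)) = fact (2 * m) / (2 ^ m * fact m) * expectation (\<lambda>\<omega>. (W \<omega>)\<^sup>2) ^ m"
proof -
  have [measurable]: "W \<in> borel_measurable M"
    using assms(1) by (simp add: gaussian_rv_def)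
  have "integrable M (\<lambda>\<omega>. W \<omega> ^ (2 * m)) \<and>
    expectation (\<lambda>\<omega>. W \<omega> ^ (2 * m)) = fact (2 * m) / (2 ^ m * fact m) * expectation (\<lambda>\<omega>. (W \<omega>)\<^sup>2) ^ m"
    using assms(1) unfolding gaussian_rv_def
  proof (elim conjE exE disjE)
    fix \<mu> assume ae: "AE \<omega> in M. W \<omega> = \<mu>"
    have "expectation W = \<mu>"
      using integral_cong_AE[OF _ _ ae] by (simp add: prob_space)
    \<comment> \<open>Mean zero identifies the constant, so every power is almost surely
      \<open>0 ^ j\<close>, with \<open>0 ^ 0 = 1\<close>.\<close>
    with ae mean have ae: "AE \<omega> in M. W \<omega> = 0" by simp
    then have pow: "AE \<omega> in M. W \<omega> ^ j = 0 ^ j" for j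
      by auto
    have "expectation (\<lambda>\<omega>. W \<omega> ^ j) = 0 ^ j" for j
      using integral_cong_AE[OF _ _ pow] by (simp add: prob_space)
    moreover have "integrable M (\<lambda>\<omega>. W \<omega> ^ j)" for j
      by (rule integrable_cong_AE_imp[of _ "\<lambda>_. 0 ^ j"]) (use pow in \<open>auto simp: eq_commute\<close>)
    ultimately show ?thesis by (cases "m = 0") (simp_all add: prob_space power_0_left)
  next
    fix \<mu> \<sigma> assume \<sigma>: "(0::real) < \<sigma>" and D: "distributed M lborel W (normal_density \<mu> \<sigma>)"
    have [simp]: "\<mu> = 0"
      using normal_distributed_expectation[OF \<sigma> D] mean by (rule trans[OF sym])
    have mom: "integrable M (\<lambda>\<omega>. W \<omega> ^ (2 * j)) \<and>
      expectation (\<lambda>\<omega>. W \<omega> ^ (2 * j)) = fact (2 * j) / ((2 / \<sigma>\<^sup>2) ^ j * fact j)" for j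
    proof -
      have *: "has_bochner_integral lborel (\<lambda>x. normal_density \<mu> \<sigma> x * x ^ (2 * j))
          (fact (2 * j) / ((2 / \<sigma>\<^sup>2) ^ j * fact j))"
        using normal_moment_even[OF \<sigma>, of 0 j] by simp
      have "integrable M (\<lambda>\<omega>. W \<omega> ^ (2 * j))"
        by (rule distributed_integrable[OF D, THEN iffD1]) (use * in \<open>auto simp: has_bochner_integral_iff\<close>)
      moreover have "expectation (\<lambda>\<omega>. W \<omega> ^ (2 * j)) = fact (2 * j) / ((2 / \<sigma>\<^sup>2) ^ j * fact j)"
        by (subst distributed_integral[OF D, symmetric]) (use * in \<open>auto simp: has_bochner_integral_iff\<close>)
      ultimately show ?thesis by simp
    qed
    \<comment> \<open>The case \<open>j = 1\<close> identifies the density parameter with the second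
      moment.\<close>
    have "expectation (\<lambda>\<omega>. (W \<omega>)\<^sup>2) = \<sigma>\<^sup>2"
      using mom[of 1] by (simp add: fact_numeral)
    then show ?thesis
      using mom[of m] by (simp add: power_divide)
  qed
  then show "integrable M (\<lambda>\<omega>. W \<omega> ^ (2 * m))"
    and "expectation (\<lambda>\<omega>. W \<omega> ^ (2 * m)) = fact (2 * m) / (2 ^ m * fact m) * expectation (\<lambda>\<omega>. (W \<omega>)\<^sup>2) ^ m"
    by auto
qed

text \<open>A vanishing Bochner integral does not imply integrability, so linearity of expectation
  on combinations of the \<open>X t\<close> takes integrability from the Gaussian law.\<close>

lemma gaussian_rv_integrable:
  assumes "gaussian_rv M W"
  shows "integrable M W"
proof -
  have [measurable]: "W \<in> borel_measurable M"
    using assms by (simp add: gaussian_rv_def)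
  show ?thesis
    using assms unfolding gaussian_rv_def
  proof (elim conjE exE disjE)
    fix \<mu> assume "AE \<omega> in M. W \<omega> = \<mu>"
    then have "AE \<omega> in M. \<mu> = W \<omega>" by (simp add: eq_commute)
    then show ?thesis
      by (rule integrable_cong_AE_imp[rotated 2]) auto
  next
    fix \<mu> \<sigma> assume "(0::real) < \<sigma>" and D: "distributed M lborel W (normal_density \<mu> \<sigma>)"
    then show ?thesis
      using normal_moment_nz_1[of \<sigma> \<mu>] distributed_integrable_var[OF D]
      by (simp add: has_bochner_integral_iff)
  qed
qed

end

section \<open>The linear span of the process\<close>

text \<open>Joint Gaussianity enters through this space: its elements are Gaussian and it is closed
  under linear combinations, so mixed moments of two elements follow by polarisation from
  one-dimensional moments.\<close>

definition process_span :: "real set \<Rightarrow> (real \<Rightarrow> 'a \<Rightarrow> real) \<Rightarrow> ('a \<Rightarrow> real) set" where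
  "process_span T X = {\<lambda>\<omega>. \<Sum>t\<in>F. c t * X t \<omega> | F c. finite F \<and> F \<subseteq> T}"

lemma process_span_base:
  assumes "t \<in> T"
  shows "X t \<in> process_span T X"
  unfolding process_span_def using assms
  by (intro CollectI exI[of _ "{t}"] exI[of _ "\<lambda>_. 1"]) auto

lemma process_span_lincomb:
  assumes "U \<in> process_span T X" "V \<in> process_span T X"
  shows "(\<lambda>\<omega>. a * U \<omega> + b * V \<omega>) \<in> process_span T X"
proof -
  obtain F c where F: "finite F" "F \<subseteq> T" "U = (\<lambda>\<omega>. \<Sum>t\<in>F. c t * X t \<omega>)"
    using assms(1) by (auto simp: process_span_def)
  obtain G d where G: "finite G" "G \<subseteq> T" "V = (\<lambda>\<omega>. \<Sum>t\<in>G. d t * X t \<omega>)"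
    using assms(2) by (auto simp: process_span_def)
  \<comment> \<open>Both coefficient families are extended by zero to the common index set
    \<open>F \<union> G\<close>.\<close>
  let ?e = "\<lambda>t. a * (if t \<in> F then c t else 0) + b * (if t \<in> G then d t else 0)"
  have "a * U \<omega> + b * V \<omega> = (\<Sum>t\<in>F \<union> G. ?e t * X t \<omega>)" for \<omega>
  proof -
    have "U \<omega> = (\<Sum>t\<in>F \<union> G. (if t \<in> F then c t else 0) * X t \<omega>)"
      unfolding F(3) using F(1) G(1) by (intro sum.mono_neutral_cong_left) auto
    moreover have "V \<omega> = (\<Sum>t\<in>F \<union> G. (if t \<in> G then d t else 0) * X t \<omega>)"
      unfolding G(3) using F(1) G(1) by (intro sum.mono_neutral_cong_left) auto
    ultimately show ?thesis
      by (simp only: sum_distrib_left distrib_right mult.assoc flip: sum.distrib)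
  qed
  then show ?thesis
    unfolding process_span_def using F(1,2) G(1,2)
    by (intro CollectI exI[of _ "F \<union> G"] exI[of _ ?e]) auto
qed

lemma process_span_add:
  "U \<in> process_span T X \<Longrightarrow> V \<in> process_span T X \<Longrightarrow> (\<lambda>\<omega>. U \<omega> + V \<omega>) \<in> process_span T X"
  using process_span_lincomb[of U T X V 1 1] by simp

lemma process_span_diff:
  "U \<in> process_span T X \<Longrightarrow> V \<in> process_span T X \<Longrightarrow> (\<lambda>\<omega>. U \<omega> - V \<omega>) \<in> process_span T X"
  using process_span_lincomb[of U T X V 1 "-1"] by simp

section \<open>Second and fourth moments on the span\<close>

locale centered_gaussian = prob_space M for M :: "'a measure" +
  fixes T :: "real set" and X :: "real \<Rightarrow> 'a \<Rightarrow> real"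
  assumes centered_gaussian: "centered_gaussian_process M T X"
begin

lemma gaussian_rv_span: "W \<in> process_span T X \<Longrightarrow> gaussian_rv M W"
  using centered_gaussian
  by (auto simp: centered_gaussian_process_def gaussian_process_def process_span_def)

lemma measurable_span [measurable_dest]: "W \<in> process_span T X \<Longrightarrow> W \<in> borel_measurable M"
  using gaussian_rv_span by (simp add: gaussian_rv_def)

lemma expectation_span:
  assumes "W \<in> process_span T X"
  shows "expectation W = 0"
proof -
  obtain F c where F: "F \<subseteq> T" "W = (\<lambda>\<omega>. \<Sum>t\<in>F. c t * X t \<omega>)"
    using assms by (auto simp: process_span_def)
  have "integrable M (X t) \<and> expectation (X t) = 0" if "t \<in> F" for t
    using centered_gaussian that F(1) gaussian_rv_integrable[OF gaussian_rv_span[OF process_span_base]]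
    by (auto simp: centered_gaussian_process_def)
  then show ?thesis
    unfolding F(2) by (subst Bochner_Integration.integral_sum) auto
qed

lemmas span_moment = gaussian_rv_even_moment[OF gaussian_rv_span expectation_span]

lemma integrable_span_square: "W \<in> process_span T X \<Longrightarrow> integrable M (\<lambda>\<omega>. (W \<omega>)\<^sup>2)"
  using span_moment(1)[of W 1] by simp

lemma span_fourth_moment:
  assumes "W \<in> process_span T X"
  shows "integrable M (\<lambda>\<omega>. W \<omega> ^ 4)"
    and "expectation (\<lambda>\<omega>. W \<omega> ^ 4) = 3 * (expectation (\<lambda>\<omega>. (W \<omega>)\<^sup>2))\<^sup>2"
  \<comment> \<open>The constant is \<open>4! / (2^2 * 2!) = 3\<close>.\<close>
  using span_moment[OF assms assms, of 2] by (simp_all add: fact_numeral)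

lemma integrable_span_mult:
  assumes "U \<in> process_span T X" "V \<in> process_span T X"
  shows "integrable M (\<lambda>\<omega>. U \<omega> * V \<omega>)"
proof -
  have eq: "(\<lambda>\<omega>. U \<omega> * V \<omega>) = (\<lambda>\<omega>. ((U \<omega> + V \<omega>)\<^sup>2 - (U \<omega>)\<^sup>2 - (V \<omega>)\<^sup>2) / 2)"
    by (simp add: power2_eq_square algebra_simps)
  show ?thesis
    unfolding eq using assms
    by (intro integrable_divide Bochner_Integration.integrable_diff integrable_span_square process_span_add)
qed

text \<open>Isserlis' formula, obtained by polarising the fourth moment of \<open>U \<plusminus> V\<close>.\<close>

lemma isserlis:
  assumes U: "U \<in> process_span T X" and V: "V \<in> process_span T X"
  shows "integrable M (\<lambda>\<omega>. (U \<omega>)\<^sup>2 * (V \<omega>)\<^sup>2)"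
    and "expectation (\<lambda>\<omega>. (U \<omega>)\<^sup>2 * (V \<omega>)\<^sup>2) =
      expectation (\<lambda>\<omega>. (U \<omega>)\<^sup>2) * expectation (\<lambda>\<omega>. (V \<omega>)\<^sup>2) + 2 * (expectation (\<lambda>\<omega>. U \<omega> * V \<omega>))\<^sup>2"
proof -
  define a b c where "a = expectation (\<lambda>\<omega>. (U \<omega>)\<^sup>2)"
    and "b = expectation (\<lambda>\<omega>. U \<omega> * V \<omega>)" and "c = expectation (\<lambda>\<omega>. (V \<omega>)\<^sup>2)"
  note add = process_span_add[OF U V] and diff = process_span_diff[OF U V]
  note int = integrable_span_square[OF U] integrable_span_square[OF V] integrable_span_mult[OF U V]
  have sq: "expectation (\<lambda>\<omega>. (U \<omega> + V \<omega>)\<^sup>2) = a + 2 * b + c"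
    "expectation (\<lambda>\<omega>. (U \<omega> - V \<omega>)\<^sup>2) = a - 2 * b + c"
    using int by (simp_all add: power2_sum power2_diff mult.assoc a_def b_def c_def)
  \<comment> \<open>In the sum of the two fourth powers the odd terms cancel, and the mixed term has
    coefficient \<open>2 * 6 = 12\<close>.\<close>
  have eq: "(\<lambda>\<omega>. (U \<omega>)\<^sup>2 * (V \<omega>)\<^sup>2) =
      (\<lambda>\<omega>. ((U \<omega> + V \<omega>) ^ 4 + (U \<omega> - V \<omega>) ^ 4 - 2 * U \<omega> ^ 4 - 2 * V \<omega> ^ 4) / 12)"
    by (rule ext) (simp add: power4_eq_xxxx power2_eq_square algebra_simps)
  note int4 = span_fourth_moment(1)[OF add] span_fourth_moment(1)[OF diff]
    span_fourth_moment(1)[OF U] span_fourth_moment(1)[OF V]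
  show "integrable M (\<lambda>\<omega>. (U \<omega>)\<^sup>2 * (V \<omega>)\<^sup>2)"
    unfolding eq using int4 by simp
  have "expectation (\<lambda>\<omega>. (U \<omega>)\<^sup>2 * (V \<omega>)\<^sup>2) =
      (3 * (a + 2 * b + c)\<^sup>2 + 3 * (a - 2 * b + c)\<^sup>2 - 2 * (3 * a\<^sup>2) - 2 * (3 * c\<^sup>2)) / 12"
    unfolding eq using int4
    by (simp add: span_fourth_moment(2)[OF add] span_fourth_moment(2)[OF diff]
      span_fourth_moment(2)[OF U] span_fourth_moment(2)[OF V] sq flip: a_def c_def)
  also have "\<dots> = a * c + 2 * b\<^sup>2"
    by (simp add: power2_eq_square algebra_simps)
  finally show "expectation (\<lambda>\<omega>. (U \<omega>)\<^sup>2 * (V \<omega>)\<^sup>2) =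
      expectation (\<lambda>\<omega>. (U \<omega>)\<^sup>2) * expectation (\<lambda>\<omega>. (V \<omega>)\<^sup>2) + 2 * (expectation (\<lambda>\<omega>. U \<omega> * V \<omega>))\<^sup>2"
    by (simp add: a_def b_def c_def)
qed

end

section \<open>Uniform moment bounds for the scaled dyadic sums\<close>

locale bounded_dyadic_energy = centered_gaussian M T X for M :: "'a measure" and T X +
  fixes C :: real
  assumes unit_interval: "{0..1} \<subseteq> T"
    and expectation_energy_le: "\<And>n. expectation (\<lambda>\<omega>. dyadic_energy (\<lambda>t. X t \<omega>) n) \<le> C"
begin

abbreviation S :: "nat \<Rightarrow> 'a \<Rightarrow> real" where
  "S n \<omega> \<equiv> dyadic_energy (\<lambda>t. X t \<omega>) n"

lemma S_eq: "S n \<omega> = (\<Sum>k = 1..2 ^ n. 2 ^ n * (dyadic_increment X n k \<omega>)\<^sup>2)"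
  by (simp add: dyadic_energy_def dyadic_increment_def sum_distrib_left)

lemma dyadic_point_span:
  assumes "k \<in> {1..2 ^ n}"
  shows "X (real k / 2 ^ n) \<in> process_span T X" "X ((real k - 1) / 2 ^ n) \<in> process_span T X"
proof -
  have "real k \<le> 2 ^ n"
    using assms of_nat_le_iff[of k "2 ^ n", where ?'a = real] by simp
  \<comment> \<open>This is \<open>(k - 1) / 2 ^ n \<le> 1\<close> with the denominator
    cleared.\<close>
  moreover from this have "real k \<le> 1 + 2 ^ n"
    by linarith
  ultimately have "real k / 2 ^ n \<in> {0..1}" "(real k - 1) / 2 ^ n \<in> {0..1}"
    using assms by (auto simp: field_simps)
  then show "X (real k / 2 ^ n) \<in> process_span T X" "X ((real k - 1) / 2 ^ n) \<in> process_span T X"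
    by (auto intro!: process_span_base subsetD[OF unit_interval] simp del: atLeastAtMost_iff)
qed

lemma dyadic_increment_span:
  assumes "k \<in> {1..2 ^ n}"
  shows "dyadic_increment X n k \<in> process_span T X"
  using process_span_diff[OF dyadic_point_span[OF assms]]
  by (simp add: dyadic_increment_def[abs_def])

lemma S_measurable [measurable]: "S n \<in> borel_measurable M"
proof -
  have [measurable]: "dyadic_increment X n k \<in> borel_measurable M" if "k \<in> {1..2 ^ n}" for k
    using that by (intro measurable_span dyadic_increment_span)
  show ?thesis
    unfolding S_eq by measurable
qed

text \<open>The weighted bound is used with \<open>v\<close> the expectations of the summands.
  Gaussian moments of each increment supply a constant depending on \<open>m\<close> alone, and the
  \<open>v\<close> add up to the expectation of \<open>S n\<close>, which is at most
  \<open>C\<close>.\<close>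

lemma S_moment_le: "\<exists>K. \<forall>n. integrable M (\<lambda>\<omega>. S n \<omega> ^ m) \<and> expectation (\<lambda>\<omega>. S n \<omega> ^ m) \<le> K"
proof -
  \<comment> \<open>The fraction is the Gaussian moment constant; the maximum provides
    \<open>1 \<le> c\<close> directly.\<close>
  define c :: real where "c = max 1 (fact (2 * m) / (2 ^ m * fact m))"
  have "integrable M (\<lambda>\<omega>. S n \<omega> ^ m) \<and> expectation (\<lambda>\<omega>. S n \<omega> ^ m) \<le> c * C ^ m" for n
  proof -
    let ?x = "\<lambda>k \<omega>. 2 ^ n * (dyadic_increment X n k \<omega>)\<^sup>2"
    let ?v = "\<lambda>k. 2 ^ n * expectation (\<lambda>\<omega>. (dyadic_increment X n k \<omega>)\<^sup>2)"
    have x_pow: "?x k \<omega> ^ m = 2 ^ (n * m) * dyadic_increment X n k \<omega> ^ (2 * m)" for k \<omega>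
      by (simp add: power_mult_distrib power_mult)
    have int: "integrable M (\<lambda>\<omega>. ?x k \<omega> ^ m)" if "k \<in> {1..2 ^ n}" for k
      unfolding x_pow using span_moment(1)[OF dyadic_increment_span dyadic_increment_span, OF that that]
      by simp
    have le: "expectation (\<lambda>\<omega>. ?x k \<omega> ^ m) \<le> c * ?v k ^ m" if "k \<in> {1..2 ^ n}" for k
    proof -
      have "expectation (\<lambda>\<omega>. ?x k \<omega> ^ m) = fact (2 * m) / (2 ^ m * fact m) * ?v k ^ m"
        unfolding x_pow
        using span_moment(2)[OF dyadic_increment_span dyadic_increment_span, OF that that, of m]
        by (simp add: power_mult_distrib power_mult)
      also have "\<dots> \<le> c * ?v k ^ m"
        by (intro mult_right_mono) (auto simp: c_def)
      finally show ?thesis .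
    qed
    have null: "AE \<omega> in M. ?x k \<omega> = 0" if "k \<in> {1..2 ^ n}" "?v k = 0" for k
      using that integral_nonneg_eq_0_iff_AE[OF integrable_span_square[OF dyadic_increment_span[OF that(1)]]]
      by simp
    have meas: "?x k \<in> borel_measurable M" if "k \<in> {1..2 ^ n}" for k
      using measurable_span[OF dyadic_increment_span[OF that]] by simp
    have v: "0 \<le> ?v k" for k
      by simp
    have 1: "1 \<le> c"
      by (simp add: c_def)
    note * = expectation_sum_power_le[of "{1..2 ^ n}" ?x m c ?v, OF _ meas _ int le v null 1]
    have "(\<Sum>k = 1..2 ^ n. ?v k) = expectation (S n)"
      unfolding S_eq
      by (subst Bochner_Integration.integral_sum) (auto intro!: integrable_span_square dyadic_increment_span)
    then have "(\<Sum>k = 1..2 ^ n. ?v k) \<le> C"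
      using expectation_energy_le by simp
    then have "(\<Sum>k = 1..2 ^ n. ?v k) ^ m \<le> C ^ m"
      by (intro power_mono sum_nonneg v)
    then have "c * (\<Sum>k = 1..2 ^ n. ?v k) ^ m \<le> c * C ^ m"
      using 1 by (intro mult_left_mono) auto
    with * show ?thesis
      unfolding S_eq by (auto intro: order_trans)
  qed
  then show ?thesis by blast
qed

lemma S_integrable: "integrable M (S n)"
  using S_moment_le[of 1] by auto

section \<open>The pointwise limit and its moments\<close>

text \<open>Taking the supremum in \<open>ennreal\<close> makes it exist at every sample point and
  keeps it measurable. Where it is infinite, \<open>enn2real\<close> returns 0; this happens only on
  a null set.\<close>

definition Y :: "'a \<Rightarrow> real" where
  "Y \<omega> = enn2real (SUP n. ennreal (S n \<omega>))"

lemma Y_measurable [measurable]: "Y \<in> borel_measurable M"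
  unfolding Y_def[abs_def] by measurable

lemma Y_nonneg: "0 \<le> Y \<omega>"
  by (simp add: Y_def)

text \<open>By monotone convergence the supremum has integral at most \<open>C\<close>, hence is
  finite almost everywhere, and there the increasing sums converge to it.\<close>

lemma S_tendsto_Y: "AE \<omega> in M. (\<lambda>n. S n \<omega>) \<longlonglongrightarrow> Y \<omega>"
proof -
  have inc: "incseq (\<lambda>n. ennreal (S n \<omega>))" for \<omega>
    using incseq_dyadic_energy by (auto simp: incseq_def intro!: ennreal_leI)
  have "(\<integral>\<^sup>+\<omega>. (SUP n. ennreal (S n \<omega>)) \<partial>M) = (SUP n. \<integral>\<^sup>+\<omega>. ennreal (S n \<omega>) \<partial>M)"
    using inc by (intro nn_integral_monotone_convergence_SUP) (auto simp: incseq_def le_fun_def)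
  also have "\<dots> \<le> ennreal C"
    using expectation_energy_le
    by (intro SUP_least) (simp add: nn_integral_eq_integral S_integrable dyadic_energy_nonneg ennreal_leI)
  finally have "AE \<omega> in M. (SUP n. ennreal (S n \<omega>)) \<noteq> \<infinity>"
    by (intro nn_integral_PInf_AE) (auto simp: top_unique)
  then show ?thesis
  proof eventually_elim
    case (elim \<omega>)
    then have "ennreal (Y \<omega>) = (SUP n. ennreal (S n \<omega>))"
      unfolding Y_def infinity_ennreal_def by (simp only: ennreal_enn2real_if if_False)
    then have "(\<lambda>n. ennreal (S n \<omega>)) \<longlonglongrightarrow> ennreal (Y \<omega>)"
      using LIMSEQ_SUP[OF inc] by simp
    then show ?case
      using Y_nonneg dyadic_energy_nonneg by (intro tendsto_ennrealD) auto
  qed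
qed

lemma S_le_Y: "AE \<omega> in M. \<forall>n. S n \<omega> \<le> Y \<omega>"
  using S_tendsto_Y by eventually_elim (intro allI incseq_le[OF incseq_dyadic_energy])

text \<open>Monotone convergence applies to \<open>S n ^ m\<close>: the expectations increase and
  are bounded by \<open>K\<close>, so they have a finite limit.\<close>

lemma Y_power_integrable: "integrable M (\<lambda>\<omega>. Y \<omega> ^ m)"
proof -
  obtain K where K: "\<And>n. integrable M (\<lambda>\<omega>. S n \<omega> ^ m)" "\<And>n. expectation (\<lambda>\<omega>. S n \<omega> ^ m) \<le> K"
    using S_moment_le[of m] by blast
  have mono: "S i \<omega> ^ m \<le> S j \<omega> ^ m" if "i \<le> j" for i j \<omega>
    using incseq_dyadic_energy that by (intro power_mono dyadic_energy_nonneg) (simp add: incseq_def)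
  have "incseq (\<lambda>n. expectation (\<lambda>\<omega>. S n \<omega> ^ m))"
    using K(1) mono by (auto simp: incseq_def intro!: integral_mono)
  then obtain L where L: "(\<lambda>n. expectation (\<lambda>\<omega>. S n \<omega> ^ m)) \<longlonglongrightarrow> L"
    using K(2) incseq_convergent by blast
  show ?thesis
  proof (rule integral_monotone_convergence_nonneg(1)[OF K(1) _ _ _ L])
    show "AE \<omega> in M. mono (\<lambda>n. S n \<omega> ^ m)"
      using mono by (simp add: mono_def)
    show "AE \<omega> in M. (\<lambda>n. S n \<omega> ^ m) \<longlonglongrightarrow> Y \<omega> ^ m"
      using S_tendsto_Y by eventually_elim (rule tendsto_power)
  qed (auto simp: dyadic_energy_nonneg)
qed

lemma Y_powr_integrable:
  assumes "0 \<le> p"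
  shows "integrable M (\<lambda>\<omega>. Y \<omega> powr p)"
proof -
  \<comment> \<open>Rounding \<open>p\<close> up gives an integer moment; the term 1 in the bound
    \<open>1 + y ^ m\<close> handles \<open>y \<le> 1\<close>, where a larger exponent would make
    the power smaller.\<close>
  define m where "m = nat \<lceil>p\<rceil>"
  have m: "p \<le> real m"
    using assms by (simp add: m_def)
  have "y powr p \<le> 1 + y ^ m" if "0 \<le> y" for y
  proof (cases "y \<le> 1")
    case True
    then show ?thesis using powr_le1[OF assms, of y] that by (simp add: add_increasing2)
  next
    case False
    then have "y powr p \<le> y powr real m"
      using m by (intro powr_mono) auto
    then show ?thesis using False by (simp add: powr_realpow)
  qed
  then have "AE \<omega> in M. norm (Y \<omega> powr p) \<le> norm (1 + Y \<omega> ^ m)"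
    using Y_nonneg by auto
  then show ?thesis
    by (rule Bochner_Integration.integrable_bound[rotated 2]) (auto intro: Y_power_integrable)
qed

section \<open>Convergence in \<open>L^p\<close>\<close>

text \<open>Dominated convergence with majorant \<open>Y powr p\<close>: almost surely
  \<open>0 \<le> S n \<le> Y\<close>, so both \<open>S n\<close> and the distance from
  \<open>S n\<close> to \<open>Y\<close> are at most \<open>Y\<close>.\<close>

lemma converges_in_Lp_Y:
  assumes p: "1 < p"
  shows "converges_in_Lp M p S Y"
proof -
  have int: "integrable M (\<lambda>\<omega>. Y \<omega> powr p)"
    using p by (intro Y_powr_integrable) simp
  have "integrable M (\<lambda>\<omega>. \<bar>S n \<omega>\<bar> powr p)" for n
  proof (rule Bochner_Integration.integrable_bound[OF int])
    show "AE \<omega> in M. norm (\<bar>S n \<omega>\<bar> powr p) \<le> norm (Y \<omega> powr p)"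
      using S_le_Y by eventually_elim (use p in \<open>simp add: dyadic_energy_nonneg powr_mono2\<close>)
  qed simp
  then have "in_Lp M p (S n)" for n
    by (simp add: in_Lp_def)
  moreover have "in_Lp M p Y"
    using int by (simp add: in_Lp_def Y_nonneg)
  moreover have "(\<lambda>n. Lp_norm M p (\<lambda>\<omega>. S n \<omega> - Y \<omega>)) \<longlonglongrightarrow> 0"
  proof -
    have "(\<lambda>n. expectation (\<lambda>\<omega>. \<bar>S n \<omega> - Y \<omega>\<bar> powr p)) \<longlonglongrightarrow> expectation (\<lambda>_. 0)"
    proof (rule integral_dominated_convergence[OF _ _ int])
      show "AE \<omega> in M. (\<lambda>n. \<bar>S n \<omega> - Y \<omega>\<bar> powr p) \<longlonglongrightarrow> 0"
        using S_tendsto_Y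
      proof eventually_elim
        case (elim \<omega>)
        then have "(\<lambda>n. \<bar>S n \<omega> - Y \<omega>\<bar>) \<longlonglongrightarrow> 0"
          by (simp add: tendsto_rabs_zero_iff LIM_zero_iff)
        then show ?case
          using p by (intro tendsto_zero_powrI[OF _ tendsto_const]) auto
      qed
      show "AE \<omega> in M. norm (\<bar>S n \<omega> - Y \<omega>\<bar> powr p) \<le> Y \<omega> powr p" for n
        using S_le_Y
      proof eventually_elim
        case (elim \<omega>)
        then have "\<bar>S n \<omega> - Y \<omega>\<bar> \<le> Y \<omega>"
          using dyadic_energy_nonneg[of "\<lambda>t. X t \<omega>" n] spec[of _ n] by (auto simp: abs_le_iff algebra_simps)
        then show ?case
          using p by (simp add: powr_mono2)
      qed
    qed auto
    then show ?thesis
      unfolding Lp_norm_def using p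
      by (intro tendsto_zero_powrI[OF _ tendsto_const]) auto
  qed
  ultimately show ?thesis
    by (simp add: converges_in_Lp_def)
qed

section \<open>Correlation with a squared increment and nonconstancy\<close>

text \<open>Isserlis' formula is applied to each increment and \<open>U\<close>. The covariance of
  an increment with \<open>U\<close> is the increment of \<open>t \<mapsto> E[X t * U]\<close>, so
  the squared covariances assemble into the energy of that function.\<close>

lemma expectation_S_mult_square:
  assumes U: "U \<in> process_span T X"
  shows "expectation (\<lambda>\<omega>. S n \<omega> * (U \<omega>)\<^sup>2) = expectation (S n) * expectation (\<lambda>\<omega>. (U \<omega>)\<^sup>2)
    + 2 * dyadic_energy (\<lambda>t. expectation (\<lambda>\<omega>. X t \<omega> * U \<omega>)) n"
proof -
  let ?d = "dyadic_increment X n"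
  have cov: "expectation (\<lambda>\<omega>. ?d k \<omega> * U \<omega>) =
      expectation (\<lambda>\<omega>. X (real k / 2 ^ n) \<omega> * U \<omega>) - expectation (\<lambda>\<omega>. X ((real k - 1) / 2 ^ n) \<omega> * U \<omega>)"
    if "k \<in> {1..2 ^ n}" for k
    using integrable_span_mult[OF dyadic_point_span(1)[OF that] U]
      integrable_span_mult[OF dyadic_point_span(2)[OF that] U]
    by (simp add: dyadic_increment_def left_diff_distrib)
  have "expectation (\<lambda>\<omega>. S n \<omega> * (U \<omega>)\<^sup>2) = (\<Sum>k = 1..2 ^ n. 2 ^ n * expectation (\<lambda>\<omega>. (?d k \<omega>)\<^sup>2 * (U \<omega>)\<^sup>2))"
    unfolding S_eq sum_distrib_right mult.assoc
    by (subst Bochner_Integration.integral_sum) (auto intro!: isserlis(1) dyadic_increment_span U)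
  also have "\<dots> = (\<Sum>k = 1..2 ^ n. 2 ^ n * (expectation (\<lambda>\<omega>. (?d k \<omega>)\<^sup>2) * expectation (\<lambda>\<omega>. (U \<omega>)\<^sup>2)
      + 2 * (expectation (\<lambda>\<omega>. X (real k / 2 ^ n) \<omega> * U \<omega>) - expectation (\<lambda>\<omega>. X ((real k - 1) / 2 ^ n) \<omega> * U \<omega>))\<^sup>2))"
    by (intro sum.cong refl) (simp add: isserlis(2)[OF dyadic_increment_span U] cov)
  also have "\<dots> = (\<Sum>k = 1..2 ^ n. 2 ^ n * expectation (\<lambda>\<omega>. (?d k \<omega>)\<^sup>2)) * expectation (\<lambda>\<omega>. (U \<omega>)\<^sup>2)
    + 2 * dyadic_energy (\<lambda>t. expectation (\<lambda>\<omega>. X t \<omega> * U \<omega>)) n"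
    by (simp add: dyadic_energy_def sum.distrib sum_distrib_left sum_distrib_right algebra_simps)
  also have "(\<Sum>k = 1..2 ^ n. 2 ^ n * expectation (\<lambda>\<omega>. (?d k \<omega>)\<^sup>2)) = expectation (S n)"
    unfolding S_eq
    by (subst Bochner_Integration.integral_sum) (auto intro!: integrable_span_square dyadic_increment_span)
  finally show ?thesis .
qed

text \<open>If \<open>Y\<close> were a constant \<open>c\<close>, the covariance of
  \<open>S i\<close> with the square of \<open>U\<close> would tend to 0. It is twice an energy that
  increases in \<open>i\<close> and is positive once \<open>i\<close> reaches the level of
  \<open>U\<close>.\<close>

lemma nonconstant_Y:
  assumes "\<not> dyadically_constant M X"
  shows "nonconstant_rv M Y"
proof -
  obtain n k where k: "k \<in> {1..2 ^ n}" and nz: "\<not> (AE \<omega> in M. dyadic_increment X n k \<omega> = 0)"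
    using assms by (auto simp: dyadically_constant_def)
  define U where "U = dyadic_increment X n k"
  have U: "U \<in> process_span T X"
    unfolding U_def by (rule dyadic_increment_span[OF k])
  define s where "s = expectation (\<lambda>\<omega>. (U \<omega>)\<^sup>2)"
  have "s \<noteq> 0"
    using nz integral_nonneg_eq_0_iff_AE[OF integrable_span_square[OF U]] by (simp add: s_def U_def)
  define \<phi> where "\<phi> t = expectation (\<lambda>\<omega>. X t \<omega> * U \<omega>)" for t
  \<comment> \<open>Over the interval that defines \<open>U\<close>, the increment of
    \<open>\<phi>\<close> is the covariance of \<open>U\<close> with itself.\<close>
  have "\<phi> (real k / 2 ^ n) - \<phi> ((real k - 1) / 2 ^ n) = s"
    using integrable_span_mult[OF dyadic_point_span(1)[OF k] U]
      integrable_span_mult[OF dyadic_point_span(2)[OF k] U]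
    by (simp add: \<phi>_def s_def U_def dyadic_increment_def power2_eq_square flip: left_diff_distrib
      Bochner_Integration.integral_diff)
  then have "s\<^sup>2 \<le> (\<Sum>k = 1..2 ^ n. (\<phi> (real k / 2 ^ n) - \<phi> ((real k - 1) / 2 ^ n))\<^sup>2)"
    using member_le_sum[OF k, of "\<lambda>k. (\<phi> (real k / 2 ^ n) - \<phi> ((real k - 1) / 2 ^ n))\<^sup>2"] by simp
  then have "0 < (\<Sum>k = 1..2 ^ n. (\<phi> (real k / 2 ^ n) - \<phi> ((real k - 1) / 2 ^ n))\<^sup>2)"
    by (rule less_le_trans[rotated]) (simp add: \<open>s \<noteq> 0\<close>)
  then have pos: "0 < dyadic_energy \<phi> n"
    unfolding dyadic_energy_def by (rule mult_pos_pos[rotated]) simp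
  show ?thesis
    unfolding nonconstant_rv_def
  proof (intro conjI notI Y_measurable)
    assume "\<exists>c. AE \<omega> in M. Y \<omega> = c"
    then obtain c where c: "AE \<omega> in M. Y \<omega> = c" by blast
    \<comment> \<open>This is applied with \<open>g\<close> the square of \<open>U\<close> and with
      \<open>g = 1\<close>. The bounds \<open>0 \<le> S i \<le> Y = c\<close> make
      \<open>c * g\<close> a majorant.\<close>
    have lim: "(\<lambda>i. expectation (\<lambda>\<omega>. S i \<omega> * g \<omega>)) \<longlonglongrightarrow> c * expectation g"
      if g: "integrable M g" "\<And>\<omega>. 0 \<le> g \<omega>" for g
    proof -
      have "(\<lambda>i. expectation (\<lambda>\<omega>. S i \<omega> * g \<omega>)) \<longlonglongrightarrow> expectation (\<lambda>\<omega>. c * g \<omega>)"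
      proof (rule integral_dominated_convergence)
        show "AE \<omega> in M. (\<lambda>i. S i \<omega> * g \<omega>) \<longlonglongrightarrow> c * g \<omega>"
          using S_tendsto_Y c by eventually_elim (auto intro: tendsto_mult_right)
        show "AE \<omega> in M. norm (S i \<omega> * g \<omega>) \<le> c * g \<omega>" for i
          using S_le_Y c
          by eventually_elim (use g(2) in \<open>auto simp: abs_mult dyadic_energy_nonneg intro: mult_right_mono\<close>)
      qed (use g in auto)
      then show ?thesis by simp
    qed
    have "(\<lambda>i. expectation (\<lambda>\<omega>. S i \<omega> * (U \<omega>)\<^sup>2)) \<longlonglongrightarrow> c * s"
      unfolding s_def by (intro lim integrable_span_square U) simp
    moreover have "(\<lambda>i. expectation (S i) * s + 2 * dyadic_energy \<phi> n) \<longlonglongrightarrow> c * s + 2 * dyadic_energy \<phi> n"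
      using lim[of "\<lambda>_. 1"] by (intro tendsto_intros) (simp add: prob_space)
    \<comment> \<open>The energy stays frozen at level \<open>n\<close> while \<open>i\<close>
      grows; monotonicity makes this a lower bound that survives the limit.\<close>
    moreover have "expectation (S i) * s + 2 * dyadic_energy \<phi> n \<le> expectation (\<lambda>\<omega>. S i \<omega> * (U \<omega>)\<^sup>2)" if "n \<le> i" for i
      using incseqD[OF incseq_dyadic_energy that, of \<phi>] expectation_S_mult_square[OF U, of i]
      by (simp add: s_def \<phi>_def[abs_def])
    ultimately have "c * s + 2 * dyadic_energy \<phi> n \<le> c * s"
      by (intro LIMSEQ_le) blast+
    with pos show False by simp
  qed
qed

end

text \<open>One limit \<open>Y\<close> serves all exponents. The guard on nonconstancy excludes the
  processes whose dyadic increments all vanish almost surely.\<close>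

theorem proposition2p3:
  fixes M :: "'a measure" and X :: "real \<Rightarrow> 'a \<Rightarrow> real"
  assumes "prob_space M"
    and "centered_gaussian_process M {0..} X"
    and "(SUP n. ereal (2 ^ n * (\<Sum>k = 1..2 ^ n. \<integral>\<omega>. (dyadic_increment X n k \<omega>)\<^sup>2 \<partial>M))) < \<infinity>"
  shows "\<exists>Y. (\<not> dyadically_constant M X \<longrightarrow> nonconstant_rv M Y) \<and>
           (\<forall>p>1. converges_in_Lp M p
              (\<lambda>n \<omega>. 2 ^ n * (\<Sum>k = 1..2 ^ n. (dyadic_increment X n k \<omega>)\<^sup>2)) Y)"
proof -
  interpret centered_gaussian M "{0..}" X
    using assms(1,2) by (intro centered_gaussian.intro centered_gaussian_axioms.intro)
  let ?e = "\<lambda>n. 2 ^ n * (\<Sum>k = 1..2 ^ n. \<integral>\<omega>. (dyadic_increment X n k \<omega>)\<^sup>2 \<partial>M)"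
  \<comment> \<open>A supremum below infinity lies below some real \<open>C\<close>, which becomes
    the locale parameter.\<close>
  obtain C where "(SUP n. ereal (?e n)) \<le> ereal C"
    using assms(3) by (cases "SUP n. ereal (?e n)") auto
  then have "ereal (?e n) \<le> ereal C" for n
    by (rule order_trans[OF SUP_upper[OF UNIV_I]])
  then have C: "?e n \<le> C" for n
    by simp
  have energy: "(\<lambda>\<omega>. dyadic_energy (\<lambda>t. X t \<omega>) n) = (\<lambda>\<omega>. 2 ^ n * (\<Sum>k = 1..2 ^ n. (dyadic_increment X n k \<omega>)\<^sup>2))" for n
    by (simp add: dyadic_energy_def dyadic_increment_def)
  \<comment> \<open>This membership gives the square integrability that lets expectation and sum be
    exchanged, turning the hypothesis into a bound on the expected energy as the interpretation
    demands.\<close>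
  have span: "dyadic_increment X n k \<in> process_span {0..} X" if "k \<in> {1..2 ^ n}" for n k
    using process_span_diff[OF process_span_base process_span_base, of "real k / 2 ^ n" "{0..}" "(real k - 1) / 2 ^ n" X] that
    by (simp add: dyadic_increment_def[abs_def])
  interpret bounded_dyadic_energy M "{0..}" X C
  proof
    fix n
    have "expectation (\<lambda>\<omega>. dyadic_energy (\<lambda>t. X t \<omega>) n) = ?e n"
      unfolding energy using integrable_span_square[OF span[of _ n]] by simp
    with C show "expectation (\<lambda>\<omega>. dyadic_energy (\<lambda>t. X t \<omega>) n) \<le> C" by simp
  qed auto
  show ?thesis
    using nonconstant_Y converges_in_Lp_Y by (auto simp: energy)
qed

end
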